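(* Let $M$ and $N$ be two monoids, let $A$ be an $M$-act, and let $B$ be an $N$-act. Then $A\wr B$ is a finitely generated $\mathcal{W}(M,N|A)$-act if and only if $A$ is a finitely generated $M$-act and $B$ is a finitely generated $N$-act.
   Context: For a monoid $M$ with identity $1$, an $M$-act is a non-empty set $A$ with a map $A\times M\to A$, $(a,m)\mapsto am$, such that $a(mn)=(am)n$ and $a1=a$. A subset $U\subseteq A$ generates $A$ if every $a\in A$ equals $um$ for some $u\in U$, $m\in M$; $A$ is finitely generated if it has a finite generating set. Wreath products: let $M,N$ be monoids, $A$ an $M$-act, $B$ an $N$-act. $N^A$ is the monoid of all maps $A\to N$ (written on the right) under pointwise multiplication $a(\theta\phi)=(a\theta)(a\phi)$. For $m\in M$ and $\phi\in N^A$, ${}^m\phi\in N^A$ is given by $a\,{}^m\phi=(am)\phi$. The monoid $\mathcal{W}(M,N|A)$ is the set $M\times N^A$ with multiplication $(m,\theta)(n,\phi)=(mn,\theta\,{}^m\phi)$. The wreath product $A\wr B$ is the $\mathcal{W}(M,N|A)$-act with underlying set $A\times B$ and action $(a,b)(m,\theta)=(am,b(a\theta))$. *)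

theory Defs
  imports "HOL-Algebra.Algebra"
begin

locale monoid_act = M?: monoid M
  for M :: "('m, 'r) monoid_scheme" (structure)
    and A :: "'a set"
    and act :: "'a \<Rightarrow> 'm \<Rightarrow> 'a" +
  assumes nonempty: "A \<noteq> {}"
    and act_closed: "\<lbrakk>a \<in> A; m \<in> carrier M\<rbrakk> \<Longrightarrow> act a m \<in> A"
    and act_mult: "\<lbrakk>a \<in> A; m \<in> carrier M; n \<in> carrier M\<rbrakk> \<Longrightarrow> act a (m \<otimes> n) = act (act a m) n"
    and act_one: "a \<in> A \<Longrightarrow> act a \<one> = a"

definition generates_act ::
  "('m, 'r) monoid_scheme \<Rightarrow> 'a set \<Rightarrow> ('a \<Rightarrow> 'm \<Rightarrow> 'a) \<Rightarrow> 'a set \<Rightarrow> bool" where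
  "generates_act M A act U \<longleftrightarrow>
     U \<subseteq> A \<and> (\<forall>a\<in>A. \<exists>u\<in>U. \<exists>m\<in>carrier M. a = act u m)"

locale fg_monoid_act = monoid_act +
  assumes finitely_generated: "\<exists>U. finite U \<and> generates_act M A act U"

text \<open>The monoid \<open>N\<^sup>A\<close> is \<^const>\<open>product_group\<close> with constant factors; its elements are maps
  on \<open>A\<close>, extended by \<^const>\<open>undefined\<close> outside \<open>A\<close>.\<close>

definition map_monoid :: "'a set \<Rightarrow> ('n, 's) monoid_scheme \<Rightarrow> ('a \<Rightarrow> 'n) monoid" where
  "map_monoid A N = product_group A (\<lambda>_. N)"

text \<open>\<open>\<^sup>m\<phi>\<close>, restricted to \<open>A\<close> so that it is again an element of \<^const>\<open>map_monoid\<close>.\<close>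

definition shift_map ::
  "'a set \<Rightarrow> ('a \<Rightarrow> 'm \<Rightarrow> 'a) \<Rightarrow> 'm \<Rightarrow> ('a \<Rightarrow> 'n) \<Rightarrow> 'a \<Rightarrow> 'n" where
  "shift_map A act m \<phi> = (\<lambda>a\<in>A. \<phi> (act a m))"

definition wreath_monoid ::
  "('m, 'r) monoid_scheme \<Rightarrow> ('n, 's) monoid_scheme \<Rightarrow> 'a set \<Rightarrow> ('a \<Rightarrow> 'm \<Rightarrow> 'a)
    \<Rightarrow> ('m \<times> ('a \<Rightarrow> 'n)) monoid" where
  "wreath_monoid M N A act =
     \<lparr>carrier = carrier M \<times> carrier (map_monoid A N),
      monoid.mult = (\<lambda>(m, \<theta>) (n, \<phi>). (m \<otimes>\<^bsub>M\<^esub> n, \<theta> \<otimes>\<^bsub>map_monoid A N\<^esub> shift_map A act m \<phi>)),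
      one = (\<one>\<^bsub>M\<^esub>, \<one>\<^bsub>map_monoid A N\<^esub>)\<rparr>"

definition wreath_act ::
  "('a \<Rightarrow> 'm \<Rightarrow> 'a) \<Rightarrow> ('b \<Rightarrow> 'n \<Rightarrow> 'b) \<Rightarrow> 'a \<times> 'b \<Rightarrow> 'm \<times> ('a \<Rightarrow> 'n) \<Rightarrow> 'a \<times> 'b" where
  "wreath_act actA actB = (\<lambda>(a, b) (m, \<theta>). (actA a m, actB b (\<theta> a)))"

lemma wreath_monoid_act:
  assumes "monoid_act M A actA" and "monoid_act N B actB"
  shows "monoid_act (wreath_monoid M N A actA) (A \<times> B) (wreath_act actA actB)"
proof -
  interpret A: monoid_act M A actA by fact
  interpret B: monoid_act N B actB by fact
  have W: "monoid (wreath_monoid M N A actA)"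
    by (rule monoidI)
      (auto simp: wreath_monoid_def map_monoid_def shift_map_def product_group_def PiE_iff
        fun_eq_iff restrict_def extensional_def A.act_closed A.act_mult A.act_one
        A.M.m_assoc B.M.m_assoc)
  show ?thesis
    by (intro monoid_act.intro W monoid_act_axioms.intro)
      (auto simp: wreath_monoid_def wreath_act_def map_monoid_def shift_map_def
        product_group_def PiE_iff A.nonempty B.nonempty A.act_closed A.act_mult A.act_one
        B.act_closed B.act_mult B.act_one)
qed

end

theory Submission
  imports Defs
begin

text \<open>An element \<open>(m, \<theta>)\<close> moves \<open>(u, v)\<close> to
  \<open>(actA u m, actB v (\<theta> u))\<close>. For a fixed \<open>u\<close>, the scalar
  \<open>m\<close> and the value \<open>\<theta> u\<close> can be chosen independently in
  \<open>M\<close> and \<open>N\<close>, so generation in the wreath product splits into generation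
  in each coordinate. If \<open>U\<close> and \<open>V\<close> generate \<open>A\<close> and
  \<open>B\<close>, then \<open>U \<times> V\<close> generates \<open>A \<times> B\<close>, with
  constant maps supplying the second coordinate (\<open>generates_wreath_act\<close>). Conversely,
  both projections of a generating set generate (\<open>generates_wreath_actD\<close>). Finite
  products and images of finite sets are finite.\<close>

lemma carrier_wreath_monoid:
  "carrier (wreath_monoid M N A actA) = carrier M \<times> (A \<rightarrow>\<^sub>E carrier N)"
  by (simp add: wreath_monoid_def map_monoid_def product_group_def)

lemma generates_wreath_act:
  assumes U: "generates_act M A actA U" and V: "generates_act N B actB V"
  shows "generates_act (wreath_monoid M N A actA) (A \<times> B) (wreath_act actA actB) (U \<times> V)"
  unfolding generates_act_def
proof (intro conjI ballI)
  show "U \<times> V \<subseteq> A \<times> B"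
    using U V by (auto simp: generates_act_def)
next
  fix p assume "p \<in> A \<times> B"
  then obtain a b where p: "p = (a, b)" "a \<in> A" "b \<in> B" by auto
  obtain u m where um: "u \<in> U" "m \<in> carrier M" "a = actA u m"
    using U p(2) by (auto simp: generates_act_def)
  obtain v n where vn: "v \<in> V" "n \<in> carrier N" "b = actB v n"
    using V p(3) by (auto simp: generates_act_def)
  \<comment> \<open>Membership in \<open>A\<close> matters: the constant map
    \<open>\<lambda>x\<in>A. n\<close> takes the value \<open>n\<close> only on \<open>A\<close> and
    is \<open>undefined\<close> elsewhere.\<close>
  have "u \<in> A" using U um(1) by (auto simp: generates_act_def)
  then have "p = wreath_act actA actB (u, v) (m, \<lambda>x\<in>A. n)"
    using p(1) um(3) vn(3) by (simp add: wreath_act_def)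
  moreover have "(m, \<lambda>x\<in>A. n) \<in> carrier (wreath_monoid M N A actA)"
    using um(2) vn(2) by (auto simp: carrier_wreath_monoid)
  ultimately show "\<exists>w\<in>U \<times> V. \<exists>k\<in>carrier (wreath_monoid M N A actA).
      p = wreath_act actA actB w k"
    using um(1) vn(1) by blast
qed

text \<open>To reach a point of one factor, pair it with any point of the other and project.
  Non-emptiness provides that partner: if \<open>B\<close> were empty, the empty set would generate
  \<open>A \<times> B\<close> and say nothing about \<open>A\<close>.\<close>

lemma generates_wreath_actD:
  assumes gen: "generates_act (wreath_monoid M N A actA) (A \<times> B) (wreath_act actA actB) U"
    and ne: "A \<noteq> {}" "B \<noteq> {}"
  shows "generates_act M A actA (fst ` U)" and "generates_act N B actB (snd ` U)"
proof -
  have sub: "U \<subseteq> A \<times> B" using gen by (simp add: generates_act_def)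
  \<comment> \<open>With \<open>(a, b)\<close> obtained from \<open>w\<close> by \<open>k\<close>,
    the witnesses are \<open>m = fst k\<close> and \<open>n = snd k (fst w)\<close>, the map
    evaluated at the first coordinate of the generator.\<close>
  have ex: "\<exists>w\<in>U. (\<exists>m\<in>carrier M. a = actA (fst w) m) \<and> (\<exists>n\<in>carrier N. b = actB (snd w) n)"
    if ab: "a \<in> A" "b \<in> B" for a b
  proof -
    have "(a, b) \<in> A \<times> B" using ab by simp
    then obtain w k where w: "w \<in> U" and k: "k \<in> carrier (wreath_monoid M N A actA)"
      and eq: "(a, b) = wreath_act actA actB w k"
      using gen unfolding generates_act_def by blast
    have "fst w \<in> A" using sub w by auto
    then have "fst k \<in> carrier M" "snd k (fst w) \<in> carrier N"
      using k by (auto simp: carrier_wreath_monoid)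
    moreover have "a = actA (fst w) (fst k)" "b = actB (snd w) (snd k (fst w))"
      using eq by (simp_all add: wreath_act_def split_beta)
    ultimately show ?thesis using w by blast
  qed
  obtain a0 b0 where 0: "a0 \<in> A" "b0 \<in> B" using ne by blast
  show "generates_act M A actA (fst ` U)"
    unfolding generates_act_def
  proof (intro conjI ballI)
    show "fst ` U \<subseteq> A" using sub by auto
    show "\<exists>u\<in>fst ` U. \<exists>m\<in>carrier M. a = actA u m" if "a \<in> A" for a
      using ex[OF that 0(2)] by blast
  qed
  show "generates_act N B actB (snd ` U)"
    unfolding generates_act_def
  proof (intro conjI ballI)
    show "snd ` U \<subseteq> B" using sub by auto
    show "\<exists>v\<in>snd ` U. \<exists>n\<in>carrier N. b = actB v n" if "b \<in> B" for b
      using ex[OF 0(1) that] by blast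
  qed
qed

theorem proposition5p1:
  fixes M :: "('m, 'r) monoid_scheme"
    and N :: "('n, 's) monoid_scheme"
    and A :: "'a set" and actA :: "'a \<Rightarrow> 'm \<Rightarrow> 'a"
    and B :: "'b set" and actB :: "'b \<Rightarrow> 'n \<Rightarrow> 'b"
  assumes "monoid M" and "monoid N"
    and "monoid_act M A actA" and "monoid_act N B actB"
  shows "fg_monoid_act (wreath_monoid M N A actA) (A \<times> B) (wreath_act actA actB)
     \<longleftrightarrow> fg_monoid_act M A actA \<and> fg_monoid_act N B actB"
proof -
  have ne: "A \<noteq> {}" "B \<noteq> {}"
    using assms(3,4) by (simp_all add: monoid_act.nonempty)
  have "(\<exists>W. finite W \<and>
        generates_act (wreath_monoid M N A actA) (A \<times> B) (wreath_act actA actB) W) \<longleftrightarrow>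
      (\<exists>U. finite U \<and> generates_act M A actA U) \<and> (\<exists>V. finite V \<and> generates_act N B actB V)"
    (is "?W \<longleftrightarrow> ?U \<and> ?V")
  proof
    assume ?W
    then obtain W where "finite W"
      and W: "generates_act (wreath_monoid M N A actA) (A \<times> B) (wreath_act actA actB) W"
      by blast
    then have "finite (fst ` W)" "finite (snd ` W)" by simp_all
    with generates_wreath_actD[OF W ne] show "?U \<and> ?V" by blast
  next
    assume "?U \<and> ?V"
    then obtain U V where "finite U" "generates_act M A actA U"
      and "finite V" "generates_act N B actB V"
      by blast
    then have "finite (U \<times> V)" and
      "generates_act (wreath_monoid M N A actA) (A \<times> B) (wreath_act actA actB) (U \<times> V)"
      by (simp_all add: generates_wreath_act)
    then show ?W by blast
  qed
  \<comment> \<open>All three structures are already known to be acts, so the locale predicates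
    differ from the equivalence just shown only by facts that hold.\<close>
  then show ?thesis
    using assms(3,4) wreath_monoid_act[OF assms(3,4)]
    by (simp add: fg_monoid_act_def fg_monoid_act_axioms_def)
qed

end
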